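(* Let $\kappa$ be an infinite cardinal, let $X$ be a $\kappa$-homeoclastic topological space and let $G$ be a group acting on $X$ by homeomorphisms. If $G$ fully emulates $\operatorname{Homeo}(X)$, then $G$ has at least $2^{2^{\kappa}}$ distinct maximal subgroups. Moreover, if in addition $X$ has a basis of size $\kappa$ and the kernel of the action of $G$ on $X$ has size at most $2^{\kappa}$, then $G$ has precisely $2^{2^{\kappa}}$ maximal subgroups.
   Context: A proper subgroup $M$ of a group $G$ is maximal if there is no subgroup $H$ of $G$ with $M<H<G$. $\operatorname{Homeo}(X)$ is the group of all homeomorphisms of the space $X$. An action of a group $G$ on a topological space $X$ is a homomorphism $\phi_G:G\to\operatorname{Homeo}(X)$ (not necessarily injective); actions are written on the right, so $(x)g$ means $(x)((g)\phi_G)$, $(U)g$ is the image of $U\subseteq X$, and $g{\restriction}_U$ means $((g)\phi_G){\restriction}_U$. The kernel of the action is $\ker\phi_G$. A subset $M$ of a topological space $X$ is a topological moiety of $X$ if $M$ is clopen and the spaces $M$, $X\setminus M$ and $X$ are pairwise homeomorphic. A non-empty topological space $X$ is homeoclastic if: (1) $X$ is Hausdorff; (2) the topological moieties of $X$ form a subbasis for $X$; (3) whenever $\{A,B\}$ is a partition of $X$ into two clopen sets, then $A$ or $B$ is homeomorphic to $X$; (4) a clopen subspace of $X$ is homeomorphic to $X$ if and only if it contains a topological moiety of $X$. For an infinite cardinal $\kappa$, $X$ is $\kappa$-homeoclastic if $X$ is homeoclastic and $X$ can be partitioned into $\kappa$ topological moieties. $G$ acts fully on $X$ if: whenever $h\in\operatorname{Homeo}(X)$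 is such that there is an open cover $\mathcal C$ of $X$ with $h{\restriction}_U\in\{g{\restriction}_U : g\in G\}$ for all $U\in\mathcal C$, there is $h'\in G$ with $(h')\phi_G=h$. For $X$ homeoclastic, $G$ emulates $\operatorname{Homeo}(X)$ if for any finite partitions $\mathcal P,\mathcal Q$ of $X$ into topological moieties with $|\mathcal P|=|\mathcal Q|$ and any bijection $\phi:\mathcal P\to\mathcal Q$, there exists $g_\phi\in G$ such that $(P)g_\phi=(P)\phi$ for all $P\in\mathcal P$. $G$ fully emulates $\operatorname{Homeo}(X)$ if $G$ emulates $\operatorname{Homeo}(X)$ and acts fully on $X$. *)

theory Defs
  imports
    "HOL-Analysis.Analysis"
    "HOL-Algebra.Coset"
    "HOL-Library.Disjoint_Sets"
begin

unbundle cardinal_syntax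

text \<open>
  Spaces are values of type \<open>'a topology\<close>, so that subspaces of \<open>X\<close> are again spaces of the same
  kind.  Infinite cardinals are relations \<open>\<kappa>\<close> with \<open>Cinfinite \<kappa>\<close>; comparisons
  such as \<open>\<kappa> \<le>o |A|\<close> may relate sets over different types.
\<close>

definition maximal_subgroup :: "'g set \<Rightarrow> ('g, 'b) monoid_scheme \<Rightarrow> bool" where
  "maximal_subgroup M G \<longleftrightarrow>
     subgroup M G \<and> M \<noteq> carrier G \<and>
     (\<nexists>H. subgroup H G \<and> M \<subset> H \<and> H \<subset> carrier G)"

text \<open>
  A homeomorphism is represented by the function that is \<open>undefined\<close> outside the space, so that each
  homeomorphism has exactly one representative.  Since actions are on the right, the product of
  \<open>f\<close> and \<open>g\<close> is ``first \<open>f\<close>, then \<open>g\<close>''.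
\<close>

definition homeo_group :: "'a topology \<Rightarrow> ('a \<Rightarrow> 'a) monoid" where
  "homeo_group X =
     \<lparr>carrier = {f \<in> extensional (topspace X). homeomorphic_map X X f},
      mult = (\<lambda>f g. compose (topspace X) g f),
      one = (\<lambda>x\<in>topspace X. x)\<rparr>"

lemma homeomorphic_map_restrict:
  "homeomorphic_map X Y (restrict f (topspace X)) \<longleftrightarrow> homeomorphic_map X Y f"
  by (metis homeomorphic_map_eq restrict_apply')

lemma group_homeo_group: "group (homeo_group X)"
proof (rule groupI)
  show "\<exists>g\<in>carrier (homeo_group X). g \<otimes>\<^bsub>homeo_group X\<^esub> f = \<one>\<^bsub>homeo_group X\<^esub>"
    if "f \<in> carrier (homeo_group X)" for f
  proof -
    from that obtain g where g: "homeomorphic_maps X X f g"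
      by (auto simp: homeo_group_def homeomorphic_map_maps)
    then have "homeomorphic_map X X g"
      using homeomorphic_maps_map by blast
    with g show ?thesis
      by (intro bexI[of _ "restrict g (topspace X)"])
        (auto simp: homeo_group_def homeomorphic_map_restrict homeomorphic_maps_def compose_def
          fun_eq_iff)
  qed
next
  fix f g assume "f \<in> carrier (homeo_group X)" "g \<in> carrier (homeo_group X)"
  then show "f \<otimes>\<^bsub>homeo_group X\<^esub> g \<in> carrier (homeo_group X)"
    using homeomorphic_map_compose[of X X f X g]
    by (simp add: homeo_group_def compose_def homeomorphic_map_restrict o_def)
next
  show "\<one>\<^bsub>homeo_group X\<^esub> \<in> carrier (homeo_group X)"
    using homeomorphic_map_id[of X X]
    by (simp add: homeo_group_def homeomorphic_map_restrict id_def)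
next
  fix f g h
  assume "f \<in> carrier (homeo_group X)" "g \<in> carrier (homeo_group X)" "h \<in> carrier (homeo_group X)"
  then show "f \<otimes>\<^bsub>homeo_group X\<^esub> g \<otimes>\<^bsub>homeo_group X\<^esub> h =
    f \<otimes>\<^bsub>homeo_group X\<^esub> (g \<otimes>\<^bsub>homeo_group X\<^esub> h)"
    using homeomorphic_imp_surjective_map[of X X f]
    by (auto simp: homeo_group_def compose_def fun_eq_iff)
next
  fix f assume "f \<in> carrier (homeo_group X)"
  then show "\<one>\<^bsub>homeo_group X\<^esub> \<otimes>\<^bsub>homeo_group X\<^esub> f = f"
    by (auto simp: homeo_group_def compose_def fun_eq_iff extensional_def)
qed

definition topological_moiety :: "'a topology \<Rightarrow> 'a set \<Rightarrow> bool" where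
  "topological_moiety X M \<longleftrightarrow>
     openin X M \<and> closedin X M \<and>
     subtopology X M homeomorphic_space subtopology X (topspace X - M) \<and>
     subtopology X M homeomorphic_space X \<and>
     subtopology X (topspace X - M) homeomorphic_space X"

definition homeoclastic :: "'a topology \<Rightarrow> bool" where
  "homeoclastic X \<longleftrightarrow>
     topspace X \<noteq> {} \<and>
     Hausdorff_space X \<and>
     openin X =
       arbitrary union_of (finite intersection_of topological_moiety X relative_to topspace X) \<and>
     (\<forall>A B. partition_on (topspace X) {A, B} \<and> A \<noteq> B \<and>
        openin X A \<and> closedin X A \<and> openin X B \<and> closedin X B \<longrightarrow>
        subtopology X A homeomorphic_space X \<or> subtopology X B homeomorphic_space X) \<and>
     (\<forall>U. openin X U \<and> closedin X U \<longrightarrow>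
        (subtopology X U homeomorphic_space X \<longleftrightarrow> (\<exists>M\<subseteq>U. topological_moiety X M)))"

definition card_homeoclastic :: "'k rel \<Rightarrow> 'a topology \<Rightarrow> bool" where
  "card_homeoclastic \<kappa> X \<longleftrightarrow>
     homeoclastic X \<and>
     (\<exists>P. partition_on (topspace X) P \<and> (\<forall>M\<in>P. topological_moiety X M) \<and> |P| =o \<kappa>)"

definition acts_fully :: "('g, 'b) monoid_scheme \<Rightarrow> ('g \<Rightarrow> 'a \<Rightarrow> 'a) \<Rightarrow> 'a topology \<Rightarrow> bool" where
  "acts_fully G \<phi> X \<longleftrightarrow>
     (\<forall>h\<in>carrier (homeo_group X).
        (\<exists>\<C>. (\<forall>U\<in>\<C>. openin X U) \<and> \<Union>\<C> = topspace X \<and>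
           (\<forall>U\<in>\<C>. restrict h U \<in> {restrict (\<phi> g) U | g. g \<in> carrier G})) \<longrightarrow>
        (\<exists>h'\<in>carrier G. \<phi> h' = h))"

definition emulates_Homeo :: "('g, 'b) monoid_scheme \<Rightarrow> ('g \<Rightarrow> 'a \<Rightarrow> 'a) \<Rightarrow> 'a topology \<Rightarrow> bool" where
  "emulates_Homeo G \<phi> X \<longleftrightarrow>
     (\<forall>P Q f.
        finite P \<and> partition_on (topspace X) P \<and> (\<forall>M\<in>P. topological_moiety X M) \<and>
        finite Q \<and> partition_on (topspace X) Q \<and> (\<forall>M\<in>Q. topological_moiety X M) \<and>
        card P = card Q \<and> bij_betw f P Q \<longrightarrow>
        (\<exists>g\<in>carrier G. \<forall>M\<in>P. \<phi> g ` M = f M))"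

definition fully_emulates_Homeo ::
  "('g, 'b) monoid_scheme \<Rightarrow> ('g \<Rightarrow> 'a \<Rightarrow> 'a) \<Rightarrow> 'a topology \<Rightarrow> bool" where
  "fully_emulates_Homeo G \<phi> X \<longleftrightarrow> emulates_Homeo G \<phi> X \<and> acts_fully G \<phi> X"

definition has_basis_of_size :: "'a topology \<Rightarrow> 'k rel \<Rightarrow> bool" where
  "has_basis_of_size X \<kappa> \<longleftrightarrow>
     (\<exists>\<B>. openin X = arbitrary union_of (\<lambda>U. U \<in> \<B>) \<and> |\<B>| =o \<kappa>)"

end

(*
  Call a clopen set large if it is homeomorphic to X.  The clopen sets that are not large form an
  ideal, so there are ultrafilters of clopen sets consisting of large sets only.  If F, F' and F'' are
  such ultrafilters in one orbit of G and F differs from F' and F'', then some A in F lies in neither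
  F' nor F''; by the emulation and fullness hypotheses, F' can be moved to F'' by an element supported
  in the complement of A, which therefore fixes F.  So G is doubly transitive on the orbit, and the
  stabiliser of F is maximal.  The same construction separates the stabilisers of distinct
  ultrafilters.  An independent family of 2^kappa unions of members of a partition into kappa moieties
  yields 2^(2^kappa) ultrafilters.  Conversely, a homeomorphism h of a Hausdorff space is
  determined by the pairs of basic open sets U, V with h(U) contained in V, so that G has at most
  2^kappa elements, hence at most 2^(2^kappa) subgroups, under the additional hypotheses.
*)

theory Submission
  imports Defs "HOL-Algebra.Free_Abelian_Groups"
begin

section \<open>Large clopen sets and their ultrafilters\<close>

definition clopenin :: "'a topology \<Rightarrow> 'a set \<Rightarrow> bool" where
  "clopenin X U \<longleftrightarrow> openin X U \<and> closedin X U"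

definition large_in :: "'a topology \<Rightarrow> 'a set \<Rightarrow> bool" where
  "large_in X U \<longleftrightarrow> clopenin X U \<and> subtopology X U homeomorphic_space X"

lemma clopenin_subset: "clopenin X U \<Longrightarrow> U \<subseteq> topspace X"
  by (simp add: clopenin_def openin_subset)

lemma clopenin_topspace [simp]: "clopenin X (topspace X)"
  by (simp add: clopenin_def)

lemma clopenin_Int: "clopenin X U \<Longrightarrow> clopenin X V \<Longrightarrow> clopenin X (U \<inter> V)"
  and clopenin_Un: "clopenin X U \<Longrightarrow> clopenin X V \<Longrightarrow> clopenin X (U \<union> V)"
  and clopenin_Diff: "clopenin X U \<Longrightarrow> clopenin X V \<Longrightarrow> clopenin X (U - V)"
  by (auto simp: clopenin_def)

lemma clopenin_Inter:
  "finite S \<Longrightarrow> \<forall>A\<in>S. clopenin X A \<Longrightarrow> clopenin X (topspace X \<inter> \<Inter>S)"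
proof (induction S rule: finite_induct)
  case (insert A S)
  then have "clopenin X (A \<inter> (topspace X \<inter> \<Inter>S))"
    using clopenin_Int[of X A "topspace X \<inter> \<Inter>S"] by simp
  moreover have "topspace X \<inter> \<Inter>(insert A S) = A \<inter> (topspace X \<inter> \<Inter>S)"
    by auto
  ultimately show ?case
    by metis
qed simp

lemma large_in_clopenin: "large_in X U \<Longrightarrow> clopenin X U"
  by (simp add: large_in_def)

lemma large_in_topspace [simp]: "large_in X (topspace X)"
  by (simp add: large_in_def)

text \<open>Two spaces homeomorphic to \<open>X\<close> are homeomorphic to each other. Moieties can
  thus be handled through \<open>large_in\<close> alone.\<close>

lemma topological_moiety_iff:
  "topological_moiety X M \<longleftrightarrow> large_in X M \<and> large_in X (topspace X - M)"
proof -
  have "clopenin X (topspace X - M)" if "clopenin X M"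
    using that by (simp add: clopenin_Diff)
  then show ?thesis
    unfolding topological_moiety_def large_in_def clopenin_def
    using homeomorphic_space_sym homeomorphic_space_trans by blast
qed

text \<open>In a clopen subspace, relative openness and closedness agree with those in
  \<open>X\<close>. Clopen subspaces on both sides cover homeomorphisms of \<open>X\<close> as well
  as identifications of a large set with \<open>X\<close>.\<close>

lemma homeomorphic_map_clopen_image:
  assumes f: "homeomorphic_map (subtopology X U) (subtopology X V) f"
    and U: "clopenin X U" and V: "clopenin X V" and W: "clopenin X W" "W \<subseteq> U"
  shows "clopenin X (f ` W)" and "subtopology X W homeomorphic_space subtopology X (f ` W)"
proof -
  have tU: "topspace (subtopology X U) = U"
    using clopenin_subset[OF U] by auto
  have "openin (subtopology X V) (f ` W)"
    using homeomorphic_map_openness[OF f, of W] W U tU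
    by (metis clopenin_def openin_open_subtopology)
  moreover have "closedin (subtopology X V) (f ` W)"
    using homeomorphic_map_closedness[OF f, of W] W U tU
    by (metis clopenin_def closedin_closed_subtopology)
  ultimately show "clopenin X (f ` W)"
    using V by (meson clopenin_def closedin_trans_full openin_trans_full)
  have fW: "f ` W \<subseteq> V"
    using homeomorphic_imp_surjective_map[OF f] W(2) tU by auto
  have "homeomorphic_map (subtopology (subtopology X U) W) (subtopology (subtopology X V) (f ` W)) f"
    by (rule homeomorphic_map_subtopologies[OF f])
      (use W fW homeomorphic_imp_surjective_map[OF f] tU in auto)
  then show "subtopology X W homeomorphic_space subtopology X (f ` W)"
    using W(2) fW by (metis homeomorphic_map_imp_homeomorphic_space inf.absorb2 subtopology_subtopology)
qed

lemma large_in_image: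
  assumes f: "homeomorphic_map (subtopology X U) (subtopology X V) f"
    and "clopenin X U" "clopenin X V" "large_in X W" "W \<subseteq> U"
  shows "large_in X (f ` W)"
  using homeomorphic_map_clopen_image[OF f, of W] assms
  by (meson homeomorphic_space_sym homeomorphic_space_trans large_in_def)

lemma large_in_homeo_image:
  assumes "homeomorphic_map X X f" "large_in X W"
  shows "large_in X (f ` W)"
  using large_in_image[of X "topspace X" "topspace X" f W] assms
  by (simp add: clopenin_subset large_in_clopenin)

section \<open>Large sets in a homeoclastic space\<close>

locale homeoclastic_space =
  fixes X :: "'a topology"
  assumes homeoclastic: "homeoclastic X"
    and ex_moiety: "\<exists>M. topological_moiety X M"
begin

lemma large_in_iff: "large_in X U \<longleftrightarrow> clopenin X U \<and> (\<exists>M\<subseteq>U. topological_moiety X M)"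
proof -
  have "\<forall>U. openin X U \<and> closedin X U \<longrightarrow>
      (subtopology X U homeomorphic_space X \<longleftrightarrow> (\<exists>M\<subseteq>U. topological_moiety X M))"
    using homeoclastic unfolding homeoclastic_def by (elim conjE)
  then show ?thesis
    unfolding large_in_def clopenin_def by (metis (no_types))
qed

lemma large_in_mono: "large_in X U \<Longrightarrow> clopenin X V \<Longrightarrow> U \<subseteq> V \<Longrightarrow> large_in X V"
  unfolding large_in_iff by blast

lemma not_large_in_empty [simp]: "\<not> large_in X {}"
proof
  assume "large_in X {}"
  then have "subtopology X {} homeomorphic_space X"
    by (simp add: large_in_def)
  then have "topspace X = {}"
    using homeomorphic_empty_space by fastforce
  then show False
    using homeoclastic by (simp add: homeoclastic_def)
qed

lemma large_in_or_compl:
  assumes A: "clopenin X A"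
  shows "large_in X A \<or> large_in X (topspace X - A)"
\<comment> \<open>Blocks of a partition are non-empty, so the clause of \<open>homeoclastic\<close>
  on two-block partitions does not cover these two sets; for them one side is the whole
  space.\<close>
proof (cases "A = {} \<or> A = topspace X")
  case False
  let ?B = "topspace X - A"
  have "partition_on (topspace X) {A, ?B}" "A \<noteq> ?B"
    using False clopenin_subset[OF A] by (auto simp: partition_on_def disjoint_def)
  moreover have "clopenin X ?B"
    by (simp add: A clopenin_Diff)
  moreover have "\<forall>A B. partition_on (topspace X) {A, B} \<and> A \<noteq> B \<and>
        openin X A \<and> closedin X A \<and> openin X B \<and> closedin X B \<longrightarrow>
        subtopology X A homeomorphic_space X \<or> subtopology X B homeomorphic_space X"
    using homeoclastic unfolding homeoclastic_def by (elim conjE)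
  ultimately show ?thesis
    using A by (simp add: large_in_def clopenin_def)
qed auto

text \<open>Carry \<open>A \<union> B\<close> onto \<open>X\<close> by a homeomorphism. There the
  image of \<open>A\<close> or its complement, the image of \<open>B - A\<close>, is large; pulling
  back gives \<open>A\<close> or \<open>B - A\<close>, hence \<open>B\<close>. This is the ideal
  property of the clopen sets that are not large.\<close>

lemma large_in_UnD:
  assumes A: "clopenin X A" and B: "clopenin X B" and AB: "large_in X (A \<union> B)"
  shows "large_in X A \<or> large_in X B"
proof -
  obtain f where f: "homeomorphic_map (subtopology X (A \<union> B)) (subtopology X (topspace X)) f"
    using AB by (auto simp: large_in_def homeomorphic_space)
  then obtain g where fg: "homeomorphic_maps (subtopology X (A \<union> B)) (subtopology X (topspace X)) f g"
    by (auto simp: homeomorphic_map_maps)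
  then have g: "homeomorphic_map (subtopology X (topspace X)) (subtopology X (A \<union> B)) g"
    using homeomorphic_maps_map by blast
  have sub: "A \<union> B \<subseteq> topspace X"
    using AB large_in_clopenin clopenin_subset by blast
  then have gf: "g (f x) = x" if "x \<in> A \<union> B" for x
    using fg that by (auto simp: homeomorphic_maps_def)
  have img: "f ` (A \<union> B) = topspace X" and inj: "inj_on f (A \<union> B)"
    using homeomorphic_imp_surjective_map[OF f] homeomorphic_imp_injective_map[OF f] sub
    by (auto simp: Int_absorb1)
  have cl: "clopenin X (A \<union> B)" "clopenin X (topspace X)"
    using A B by (auto intro: clopenin_Un)
  have fA: "clopenin X (f ` A)"
    by (rule homeomorphic_map_clopen_image(1)[OF f cl A]) auto
  consider "large_in X (f ` A)" | "large_in X (topspace X - f ` A)"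
    using large_in_or_compl[OF fA] by blast
  then show ?thesis
  proof cases
    case 1
    then have "large_in X (g ` f ` A)"
      by (rule large_in_image[OF g cl(2,1)]) (use clopenin_subset[OF fA] in auto)
    moreover have "g ` f ` A = A"
      using gf by force
    ultimately show ?thesis
      by simp
  next
    case 2
    have "topspace X - f ` A = f ` (B - A)"
      using inj_on_image_set_diff[OF inj, of "A \<union> B" A] img by auto
    then have "large_in X (g ` f ` (B - A))"
      using large_in_image[OF g cl(2,1), of "f ` (B - A)"] 2 img by auto
    moreover have "g ` f ` (B - A) = B - A"
      using gf by force
    ultimately show ?thesis
      using large_in_mono B by auto
  qed
qed

text \<open>A homeomorphism from \<open>X\<close> onto \<open>U\<close> carries a moiety of
  \<open>X\<close> and its complement to the two halves.\<close>

lemma large_in_split: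
  assumes "large_in X U"
  obtains V where "V \<subseteq> U" "large_in X V" "large_in X (U - V)"
proof -
  obtain f where f: "homeomorphic_map (subtopology X (topspace X)) (subtopology X U) f"
    using assms homeomorphic_space_sym by (auto simp: large_in_def homeomorphic_space)
  obtain M where M: "large_in X M" "large_in X (topspace X - M)"
    using ex_moiety by (auto simp: topological_moiety_iff)
  have sub: "M \<subseteq> topspace X"
    using M large_in_clopenin clopenin_subset by blast
  have U: "clopenin X U" "U \<subseteq> topspace X"
    using assms large_in_clopenin clopenin_subset by blast+
  have img: "f ` topspace X = U" and inj: "inj_on f (topspace X)"
    using homeomorphic_imp_surjective_map[OF f] homeomorphic_imp_injective_map[OF f] U by auto
  have "large_in X (f ` M)" "large_in X (f ` (topspace X - M))"
    using large_in_image[OF f clopenin_topspace U(1)] M sub by auto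
  moreover have "f ` (topspace X - M) = U - f ` M"
    using inj_on_image_set_diff[OF inj _ sub, of "topspace X"] img by auto
  ultimately show thesis
    by (intro that[of "f ` M"]) (use img sub in auto)
qed

end

section \<open>Ultrafilters consisting of large clopen sets\<close>

definition large_ultrafilter :: "'a topology \<Rightarrow> 'a set set \<Rightarrow> bool" where
  "large_ultrafilter X F \<longleftrightarrow>
     (\<forall>A\<in>F. large_in X A) \<and> (\<forall>A\<in>F. \<forall>B\<in>F. A \<inter> B \<in> F) \<and>
     (\<forall>A. clopenin X A \<longrightarrow> A \<in> F \<or> topspace X - A \<in> F)"

lemma large_ultrafilterD:
  assumes "large_ultrafilter X F"
  shows "A \<in> F \<Longrightarrow> large_in X A" "A \<in> F \<Longrightarrow> clopenin X A" "A \<in> F \<Longrightarrow> A \<subseteq> topspace X"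
    "A \<in> F \<Longrightarrow> B \<in> F \<Longrightarrow> A \<inter> B \<in> F" "clopenin X A \<Longrightarrow> A \<notin> F \<Longrightarrow> topspace X - A \<in> F"
  using assms clopenin_subset[of X A] by (auto simp: large_ultrafilter_def large_in_def)

context homeoclastic_space
begin

lemma large_ultrafilter_disjointD:
  "large_ultrafilter X F \<Longrightarrow> A \<in> F \<Longrightarrow> B \<in> F \<Longrightarrow> A \<inter> B \<noteq> {}"
  by (metis large_ultrafilterD(1,4) not_large_in_empty)

text \<open>Otherwise the complement of \<open>B\<close> would be in \<open>F\<close> and disjoint
  from \<open>A\<close>. Upward closure is thus derived from the dichotomy in
  \<open>large_ultrafilter\<close> and the largeness of its members.\<close>

lemma large_ultrafilter_mono:
  assumes F: "large_ultrafilter X F" and "A \<in> F" "clopenin X B" "A \<subseteq> B"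
  shows "B \<in> F"
proof (rule ccontr)
  assume "B \<notin> F"
  then have "A \<inter> (topspace X - B) \<noteq> {}"
    using assms by (intro large_ultrafilter_disjointD[OF F] large_ultrafilterD(5)[OF F]) auto
  then show False
    using assms by auto
qed

lemma large_ultrafilter_topspace: "large_ultrafilter X F \<Longrightarrow> topspace X \<in> F"
  using large_ultrafilterD(1)[of X F "{}"] large_ultrafilterD(5)[of X F "topspace X"] by auto

lemma large_ultrafilter_compl_iff:
  "large_ultrafilter X F \<Longrightarrow> clopenin X A \<Longrightarrow> topspace X - A \<in> F \<longleftrightarrow> A \<notin> F"
  using large_ultrafilterD(5)[of X F A] large_ultrafilter_disjointD[of F A "topspace X - A"] by auto

text \<open>A set in \<open>F'\<close> but not in \<open>F\<close> would have its complement in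
  \<open>F\<close>, hence in \<open>F'\<close>. Equalities of ultrafilters below are therefore
  proved by one inclusion.\<close>

lemma large_ultrafilter_eqI:
  assumes F: "large_ultrafilter X F" and F': "large_ultrafilter X F'" and "F \<subseteq> F'"
  shows "F = F'"
proof (rule antisym)
  show "F' \<subseteq> F"
  proof
    fix A assume "A \<in> F'"
    then show "A \<in> F"
      using assms(3) large_ultrafilter_compl_iff[OF F, of A] large_ultrafilter_compl_iff[OF F', of A]
        large_ultrafilterD(2)[OF F'] by auto
  qed
qed fact

text \<open>Zorn's lemma gives a maximal family whose finite intersections are large. If it missed
  both \<open>A\<close> and its complement, some large intersection would be the union of two sets
  that are not large, against \<open>large_in_UnD\<close>.\<close>

lemma ex_large_ultrafilter:
  assumes E: "\<forall>A\<in>E. clopenin X A"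
    and fip: "\<And>S. finite S \<Longrightarrow> S \<subseteq> E \<Longrightarrow> large_in X (topspace X \<inter> \<Inter>S)"
  obtains F where "E \<subseteq> F" "large_ultrafilter X F"
proof -
  define good where "good F \<longleftrightarrow> (\<forall>A\<in>F. clopenin X A) \<and>
    (\<forall>S. finite S \<and> S \<subseteq> F \<longrightarrow> large_in X (topspace X \<inter> \<Inter>S))" for F
  \<comment> \<open>Zorn's lemma is applied to the part added to \<open>E\<close>, so that the empty
    chain has the bound \<open>{}\<close>, which \<open>fip\<close> admits.\<close>
  have "\<exists>F\<in>{F. good (E \<union> F)}. \<forall>F'\<in>{F. good (E \<union> F)}. F \<subseteq> F' \<longrightarrow> F' = F"
  proof (rule subset_Zorn')
    fix C assume C: "subset.chain {F. good (E \<union> F)} C"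
    have "large_in X (topspace X \<inter> \<Inter>S)" if S: "finite S" "S \<subseteq> E \<union> \<Union>C" for S
    proof (cases "C = {}")
      case True
      then have "S \<subseteq> E"
        using S by simp
      then show ?thesis
        using fip[OF S(1)] by simp
    next
      case False
      have "S - E \<subseteq> \<Union>C"
        using S by blast
      then obtain F where "F \<in> C" "S - E \<subseteq> F"
        by (rule finite_subset_Union_chain[OF finite_Diff[OF S(1)] _ False C])
      then have "good (E \<union> F)" "S \<subseteq> E \<union> F"
        using C unfolding subset_chain_def by blast+
      then show ?thesis
        using S(1) unfolding good_def by simp
    qed
    moreover have "clopenin X A" if "A \<in> E \<union> \<Union>C" for A
      using that C E unfolding subset_chain_def good_def by blast
    ultimately show "\<Union>C \<in> {F. good (E \<union> F)}"
      unfolding good_def by simp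
  qed
  then obtain F0 where F0: "good (E \<union> F0)"
    and max0: "\<And>F'. good (E \<union> F') \<Longrightarrow> F0 \<subseteq> F' \<Longrightarrow> F' = F0"
    by blast
  define F where "F = E \<union> F0"
  have F: "good F" and max: "\<And>F'. good F' \<Longrightarrow> F \<subseteq> F' \<Longrightarrow> F' = F"
    subgoal using F0 by (simp add: F_def)
    subgoal for F'
      using max0[of F'] by (metis F_def Un_absorb1 le_sup_iff)
    done
  have fipF: "large_in X (topspace X \<inter> \<Inter>S)" if "finite S" "S \<subseteq> F" for S
    using F that by (simp add: good_def)
  have clF: "clopenin X A" if "A \<in> F" for A
    using F that by (simp add: good_def)
  have ultra: "A \<in> F \<or> topspace X - A \<in> F" if A: "clopenin X A" for A
  proof (rule ccontr)
    assume neg: "\<not> ?thesis"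
    \<comment> \<open>By maximality \<open>insert B F\<close> is not good; its offending finite
      subset, with \<open>B\<close> removed, is the required \<open>S\<close>.\<close>
    have ex: "\<exists>S. finite S \<and> S \<subseteq> F \<and> \<not> large_in X (B \<inter> (topspace X \<inter> \<Inter>S))"
      if B: "clopenin X B" "B \<notin> F" for B
    proof -
      have "\<not> good (insert B F)"
        using max[of "insert B F"] B by auto
      then obtain S where S: "finite S" "S \<subseteq> insert B F" "\<not> large_in X (topspace X \<inter> \<Inter>S)"
        using F B unfolding good_def by blast
      then have "B \<inter> (topspace X \<inter> \<Inter>(S - {B})) \<subseteq> topspace X \<inter> \<Inter>S"
        by auto
      moreover have "clopenin X (topspace X \<inter> \<Inter>S)"
        using S F B unfolding good_def by (intro clopenin_Inter) auto
      ultimately have "\<not> large_in X (B \<inter> (topspace X \<inter> \<Inter>(S - {B})))"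
        using S(3) large_in_mono by blast
      then show ?thesis
        using S by (intro exI[of _ "S - {B}"]) auto
    qed
    obtain S where S: "finite S" "S \<subseteq> F" "\<not> large_in X (A \<inter> (topspace X \<inter> \<Inter>S))"
      using ex[OF A] neg by blast
    obtain T where T: "finite T" "T \<subseteq> F"
      "\<not> large_in X ((topspace X - A) \<inter> (topspace X \<inter> \<Inter>T))"
      using ex[of "topspace X - A"] neg A clopenin_Diff clopenin_topspace by blast
    \<comment> \<open>The intersection over both witnesses is large, and \<open>A\<close> cuts it
      into two pieces lying in the two sets that are not large.\<close>
    let ?I = "topspace X \<inter> \<Inter>(S \<union> T)"
    have cl: "clopenin X (topspace X \<inter> \<Inter>S)" "clopenin X (topspace X \<inter> \<Inter>T)" "clopenin X ?I"
      using S T F unfolding good_def by (auto intro!: clopenin_Inter simp del: Inter_Un_distrib)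
    have "large_in X ?I"
      using F S T unfolding good_def by simp
    moreover have "?I = A \<inter> ?I \<union> (topspace X - A) \<inter> ?I"
      by auto
    ultimately have "large_in X (A \<inter> ?I \<union> (topspace X - A) \<inter> ?I)"
      by metis
    then have "large_in X (A \<inter> ?I) \<or> large_in X ((topspace X - A) \<inter> ?I)"
      by (rule large_in_UnD[OF clopenin_Int[OF A cl(3)]
            clopenin_Int[OF clopenin_Diff[OF clopenin_topspace A] cl(3)]])
    then show False
    proof
      assume "large_in X (A \<inter> ?I)"
      then have "large_in X (A \<inter> (topspace X \<inter> \<Inter>S))"
        by (rule large_in_mono[OF _ clopenin_Int[OF A cl(1)]]) auto
      with S show False by simp
    next
      assume "large_in X ((topspace X - A) \<inter> ?I)"
      then have "large_in X ((topspace X - A) \<inter> (topspace X \<inter> \<Inter>T))"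
        by (rule large_in_mono[OF _ clopenin_Int[OF clopenin_Diff[OF clopenin_topspace A] cl(2)]]) auto
      with T show False by simp
    qed
  qed
  have large: "large_in X (A \<inter> B)" if "A \<in> F" "B \<in> F" for A B
  proof -
    have "large_in X (topspace X \<inter> \<Inter>{A, B})"
      using fipF[of "{A, B}"] that by simp
    moreover have "topspace X \<inter> \<Inter>{A, B} = A \<inter> B"
      using clF[OF that(1)] clopenin_subset[of X A] by auto
    ultimately show ?thesis
      by simp
  qed
  have "A \<inter> B \<in> F" if AB: "A \<in> F" "B \<in> F" for A B
  proof (rule ccontr)
    assume "A \<inter> B \<notin> F"
    then have "topspace X - A \<inter> B \<in> F"
      using ultra[OF clopenin_Int[OF clF clF]] AB by blast
    then have "large_in X (topspace X \<inter> \<Inter>{A, B, topspace X - A \<inter> B})"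
      using fipF[of "{A, B, topspace X - A \<inter> B}"] AB by simp
    moreover have "topspace X \<inter> \<Inter>{A, B, topspace X - A \<inter> B} = {}"
      by auto
    ultimately show False
      by (metis not_large_in_empty)
  qed
  moreover have "large_in X A" if "A \<in> F" for A
    using large[OF that that] by simp
  ultimately have "large_ultrafilter X F"
    using ultra unfolding large_ultrafilter_def by blast
  then show thesis
    using that F_def by blast
qed

end

section \<open>Stabilisers of ultrafilters\<close>

locale fully_emulating_action = homeoclastic_space X + group G
  for X :: "'a topology" and G :: "('g, 'b) monoid_scheme" (structure) +
  fixes \<phi> :: "'g \<Rightarrow> 'a \<Rightarrow> 'a"
  assumes hom: "\<phi> \<in> hom G (homeo_group X)"
    and emulates: "emulates_Homeo G \<phi> X"
    and fully: "acts_fully G \<phi> X"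
begin

section \<open>The action on clopen sets and on ultrafilters\<close>

lemma act_homeomorphic: "g \<in> carrier G \<Longrightarrow> homeomorphic_map X X (\<phi> g)"
  using hom_in_carrier[OF hom] by (auto simp: homeo_group_def)

lemma act_inj: "g \<in> carrier G \<Longrightarrow> inj_on (\<phi> g) (topspace X)"
  using homeomorphic_imp_injective_map[OF act_homeomorphic] .

lemma act_mult:
  "g \<in> carrier G \<Longrightarrow> h \<in> carrier G \<Longrightarrow> x \<in> topspace X \<Longrightarrow> \<phi> (g \<otimes> h) x = \<phi> h (\<phi> g x)"
  using hom_mult[OF hom] by (simp add: homeo_group_def compose_def)

lemma act_one: "x \<in> topspace X \<Longrightarrow> \<phi> \<one> x = x"
  using group_hom.hom_one[of G "homeo_group X" \<phi>] hom group_homeo_group[of X] is_group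
  by (simp add: group_hom_def group_hom_axioms_def homeo_group_def)

lemma act_image_mult:
  "g \<in> carrier G \<Longrightarrow> h \<in> carrier G \<Longrightarrow> A \<subseteq> topspace X \<Longrightarrow> \<phi> (g \<otimes> h) ` A = \<phi> h ` \<phi> g ` A"
  unfolding image_image by (intro image_cong refl act_mult) auto

lemma act_image_one: "A \<subseteq> topspace X \<Longrightarrow> \<phi> \<one> ` A = A"
  using act_one subsetD[of A "topspace X"] by simp

lemma act_image_inv:
  assumes "g \<in> carrier G" "A \<subseteq> topspace X"
  shows "\<phi> g ` \<phi> (inv g) ` A = A"
  using act_image_mult[of "inv g" g A] act_image_one[of A] assms by simp

lemma large_in_act: "g \<in> carrier G \<Longrightarrow> large_in X A \<Longrightarrow> large_in X (\<phi> g ` A)"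
  using large_in_homeo_image[OF act_homeomorphic] .

lemma clopenin_act: "g \<in> carrier G \<Longrightarrow> clopenin X A \<Longrightarrow> clopenin X (\<phi> g ` A)"
  using homeomorphic_map_openness[OF act_homeomorphic, of g A]
    homeomorphic_map_closedness[OF act_homeomorphic, of g A] clopenin_subset[of X A]
  by (simp add: clopenin_def)

definition translate :: "'g \<Rightarrow> 'a set set \<Rightarrow> 'a set set" where
  "translate g F = (`) (\<phi> g) ` F"

text \<open>Group elements act by functions that are \<open>undefined\<close> off the space, so the
  action laws are claimed only for families of its subsets.\<close>

lemma translate_mult:
  assumes "g \<in> carrier G" "h \<in> carrier G" "F \<subseteq> Pow (topspace X)"
  shows "translate (g \<otimes> h) F = translate h (translate g F)"
proof -
  have "\<phi> (g \<otimes> h) ` A = \<phi> h ` \<phi> g ` A" if "A \<in> F" for A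
    using act_image_mult[OF assms(1,2), of A] assms(3) that by auto
  then show ?thesis
    by (simp add: translate_def image_image)
qed

lemma translate_one:
  assumes "F \<subseteq> Pow (topspace X)"
  shows "translate \<one> F = F"
proof -
  have "\<phi> \<one> ` A = A" if "A \<in> F" for A
    using act_image_one[of A] assms that by auto
  then show ?thesis
    by (simp add: translate_def)
qed

lemma large_ultrafilter_Pow: "large_ultrafilter X F \<Longrightarrow> F \<subseteq> Pow (topspace X)"
  using large_ultrafilterD(3)[of X F] by auto

lemma large_ultrafilter_translate:
  assumes g: "g \<in> carrier G" and F: "large_ultrafilter X F"
  shows "large_ultrafilter X (translate g F)"
  unfolding large_ultrafilter_def
proof (intro conjI ballI allI impI)
  show "large_in X A" if "A \<in> translate g F" for A
    using that large_in_act[OF g] large_ultrafilterD(1)[OF F] by (auto simp: translate_def)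
next
  fix A B assume "A \<in> translate g F" "B \<in> translate g F"
  then obtain A' B' where AB: "A' \<in> F" "B' \<in> F" "A = \<phi> g ` A'" "B = \<phi> g ` B'"
    by (auto simp: translate_def)
  then have "A \<inter> B = \<phi> g ` (A' \<inter> B')"
    using inj_on_image_Int[OF act_inj[OF g], of A' B'] large_ultrafilterD(3)[OF F] by simp
  then show "A \<inter> B \<in> translate g F"
    using AB large_ultrafilterD(4)[OF F] by (auto simp: translate_def)
next
  fix A assume A: "clopenin X A"
  define A' where "A' = \<phi> (inv g) ` A"
  have A': "clopenin X A'" "\<phi> g ` A' = A"
    using clopenin_act[of "inv g" A] act_image_inv[OF g] A g clopenin_subset[OF A]
    by (auto simp: A'_def)
  have "\<phi> g ` (topspace X - A') = topspace X - A"
    using inj_on_image_set_diff[OF act_inj[OF g], of "topspace X" A'] clopenin_subset[OF A'(1)] A'(2)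
      homeomorphic_imp_surjective_map[OF act_homeomorphic[OF g]] by auto
  then show "A \<in> translate g F \<or> topspace X - A \<in> translate g F"
    using large_ultrafilterD(5)[OF F A'(1)] A'(2) by (metis image_eqI translate_def)
qed

text \<open>Fullness in usable form. Continuity and openness are local, so \<open>h\<close> inherits
  them from the group elements it agrees with and, being bijective, is a homeomorphism; the sets of
  agreement form the cover in \<open>acts_fully\<close>.\<close>

lemma ex_glued:
  assumes h: "bij_betw h (topspace X) (topspace X)"
    and loc: "\<And>x. x \<in> topspace X \<Longrightarrow> \<exists>U g. openin X U \<and> x \<in> U \<and> g \<in> carrier G \<and> (\<forall>y\<in>U. h y = \<phi> g y)"
  obtains g where "g \<in> carrier G" "\<And>x. x \<in> topspace X \<Longrightarrow> \<phi> g x = h x"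
proof -
  have "continuous_map X X h"
    unfolding continuous_map_def
  proof (intro conjI allI impI)
    show "h \<in> topspace X \<rightarrow> topspace X"
      using bij_betw_imp_funcset[OF h] .
    fix V assume V: "openin X V"
    show "openin X {x \<in> topspace X. h x \<in> V}"
    proof (subst openin_subopen, rule ballI)
      fix x assume x: "x \<in> {x \<in> topspace X. h x \<in> V}"
      then have "x \<in> topspace X"
        by simp
      from loc[OF this] obtain U g
        where U: "openin X U" "x \<in> U" "g \<in> carrier G" "\<forall>y\<in>U. h y = \<phi> g y"
        by blast
      have "continuous_map X X (\<phi> g)"
        by (simp add: U act_homeomorphic homeomorphic_imp_continuous_map)
      then have "openin X (U \<inter> {x \<in> topspace X. \<phi> g x \<in> V})"
        using V U(1) by (auto intro: openin_continuous_map_preimage)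
      moreover have "x \<in> U \<inter> {x \<in> topspace X. \<phi> g x \<in> V}"
        using U x by auto
      moreover have "U \<inter> {x \<in> topspace X. \<phi> g x \<in> V} \<subseteq> {x \<in> topspace X. h x \<in> V}"
        using U(4) by auto
      ultimately show "\<exists>T. openin X T \<and> x \<in> T \<and> T \<subseteq> {x \<in> topspace X. h x \<in> V}"
        by blast
    qed
  qed
  moreover have "open_map X X h"
    unfolding open_map_def
  proof (intro allI impI)
    fix W assume W: "openin X W"
    show "openin X (h ` W)"
    proof (subst openin_subopen, rule ballI)
      fix y assume "y \<in> h ` W"
      then obtain x where x: "x \<in> W" "y = h x"
        by blast
      have "x \<in> topspace X"
        using x(1) openin_subset[OF W] by blast
      from loc[OF this] obtain U g
        where U: "openin X U" "x \<in> U" "g \<in> carrier G" "\<forall>y\<in>U. h y = \<phi> g y"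
        by blast
      have "openin X (\<phi> g ` (U \<inter> W))"
        using homeomorphic_imp_open_map[OF act_homeomorphic[OF U(3)]] U(1) W
        by (simp add: open_map_def openin_Int)
      moreover have "y \<in> \<phi> g ` (U \<inter> W)" "\<phi> g ` (U \<inter> W) \<subseteq> h ` W"
        using x U by force+
      ultimately show "\<exists>T. openin X T \<and> y \<in> T \<and> T \<subseteq> h ` W"
        by blast
    qed
  qed
  ultimately have "homeomorphic_map X X h"
    using h by (intro bijective_open_imp_homeomorphic_map) (auto simp: bij_betw_def)
  then have carr: "restrict h (topspace X) \<in> carrier (homeo_group X)"
    by (simp add: homeo_group_def homeomorphic_map_restrict)
  define \<C> where "\<C> = {U. openin X U \<and> (\<exists>g\<in>carrier G. \<forall>y\<in>U. h y = \<phi> g y)}"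
  have "\<forall>U\<in>\<C>. openin X U"
    by (simp add: \<C>_def)
  moreover have "\<Union>\<C> = topspace X"
  proof
    show "\<Union>\<C> \<subseteq> topspace X"
      using openin_subset by (auto simp: \<C>_def)
    show "topspace X \<subseteq> \<Union>\<C>"
    proof
      fix x assume "x \<in> topspace X"
      from loc[OF this] show "x \<in> \<Union>\<C>"
        unfolding \<C>_def by blast
    qed
  qed
  moreover have "\<forall>U\<in>\<C>. restrict (restrict h (topspace X)) U \<in> {restrict (\<phi> g) U | g. g \<in> carrier G}"
  proof
    fix U assume "U \<in> \<C>"
    then obtain g where g: "openin X U" "g \<in> carrier G" "\<forall>y\<in>U. h y = \<phi> g y"
      unfolding \<C>_def by blast
    then have "restrict (restrict h (topspace X)) U = restrict (\<phi> g) U"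
      using openin_subset[OF g(1)] by (intro ext) (auto simp: restrict_def)
    then show "restrict (restrict h (topspace X)) U \<in> {restrict (\<phi> g) U | g. g \<in> carrier G}"
      using g(2) by blast
  qed
  ultimately have "\<exists>g\<in>carrier G. \<phi> g = restrict h (topspace X)"
    by (intro fully[unfolded acts_fully_def, rule_format, OF carr]) (intro exI[of _ \<C>] conjI)
  then obtain g where "g \<in> carrier G" "\<phi> g = restrict h (topspace X)"
    by blast
  then show thesis
    using that by simp
qed

text \<open>Emulation for the two-block partitions formed by a moiety and its complement.\<close>

lemma ex_act_moiety:
  assumes U: "large_in X U" "large_in X (topspace X - U)"
    and V: "large_in X V" "large_in X (topspace X - V)"
  obtains g where "g \<in> carrier G" "\<phi> g ` U = V"
proof -
  have part: "partition_on (topspace X) {W, topspace X - W}" "W \<noteq> topspace X - W"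
      "\<forall>M\<in>{W, topspace X - W}. topological_moiety X M"
    if "large_in X W" "large_in X (topspace X - W)" for W
  proof -
    have W: "W \<subseteq> topspace X" "W \<noteq> {}" "topspace X - W \<noteq> {}"
      using that clopenin_subset[OF large_in_clopenin[of X W]] not_large_in_empty by fastforce+
    then show "partition_on (topspace X) {W, topspace X - W}" "W \<noteq> topspace X - W"
      by (auto simp: partition_on_def disjoint_def)
    show "\<forall>M\<in>{W, topspace X - W}. topological_moiety X M"
      using that W by (simp add: topological_moiety_iff double_diff)
  qed
  define f where "f A = (if A = U then V else topspace X - V)" for A
  have "bij_betw f {U, topspace X - U} {V, topspace X - V}"
    using part(2)[OF U] part(2)[OF V] by (auto simp: bij_betw_def f_def inj_on_def)
  moreover have "card {U, topspace X - U} = card {V, topspace X - V}"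
    using part(2)[OF U] part(2)[OF V] by simp
  ultimately have "\<exists>g\<in>carrier G. \<forall>M\<in>{U, topspace X - U}. \<phi> g ` M = f M"
    using part(1,3)[OF U] part(1,3)[OF V]
    by (intro emulates[unfolded emulates_Homeo_def, rule_format, of _ "{V, topspace X - V}"])
      (intro conjI finite.intros; assumption)
  then obtain g where "g \<in> carrier G" "\<phi> g ` U = f U"
    by blast
  then show thesis
    using that by (simp add: f_def)
qed

text \<open>
  The witness agrees with \<open>k\<close> on a member of \<open>F\<close> so small that the remaining parts of \<open>B\<close>, in the
  domain and in the range, are moieties; the emulation hypothesis maps one to the other.
\<close>
lemma ex_supported_translate:
  assumes F: "large_ultrafilter X F" and k: "k \<in> carrier G"
    and B: "B \<in> F" "B \<in> translate k F"
  obtains g where "g \<in> carrier G" "\<And>x. x \<in> topspace X - B \<Longrightarrow> \<phi> g x = x"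
    "translate g F = translate k F"
proof -
  note kF = large_ultrafilter_translate[OF k F]
  \<comment> \<open>\<open>k\<close> carries \<open>D\<close> onto \<open>B\<close>, so
    \<open>B \<inter> D\<close> is the part of \<open>B\<close> that \<open>k\<close> keeps inside
    \<open>B\<close>.\<close>
  obtain D where D: "D \<in> F" "B = \<phi> k ` D"
    using B(2) by (auto simp: translate_def)
  have BD: "B \<inter> D \<in> F"
    using large_ultrafilterD(4)[OF F] B(1) D(1) .
  \<comment> \<open>One half lies in \<open>F\<close> and becomes \<open>C\<close>; the other is
    large and remains available outside \<open>C\<close>.\<close>
  obtain C1 where C1: "C1 \<subseteq> B \<inter> D" "large_in X C1" "large_in X (B \<inter> D - C1)"
    using large_in_split[OF large_ultrafilterD(1)[OF F BD]] .
  have "C1 \<in> F \<or> B \<inter> D - C1 \<in> F"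
  proof (rule disjCI)
    assume "B \<inter> D - C1 \<notin> F"
    then have "B \<inter> D \<inter> (topspace X - (B \<inter> D - C1)) \<in> F"
      by (intro large_ultrafilterD(4,5)[OF F] BD large_in_clopenin C1)
    also have "B \<inter> D \<inter> (topspace X - (B \<inter> D - C1)) = C1"
      using C1(1) clopenin_subset[OF large_in_clopenin[OF C1(2)]] by auto
    finally show "C1 \<in> F" .
  qed
  then obtain C where C: "C \<in> F" "C \<subseteq> B \<inter> D" "large_in X (B \<inter> D - C)"
  proof
    assume "B \<inter> D - C1 \<in> F"
    moreover have "B \<inter> D - (B \<inter> D - C1) = C1"
      using C1(1) by auto
    ultimately show thesis
      using that[of "B \<inter> D - C1"] C1(2) by auto
  qed (use that C1 in blast)
  have sub: "B \<subseteq> topspace X" "D \<subseteq> topspace X" "C \<subseteq> topspace X"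
    using large_ultrafilterD(3)[OF F] B(1) D(1) C(1) by blast+
  have cl: "clopenin X B" "clopenin X C" "clopenin X (\<phi> k ` C)"
    using large_ultrafilterD(2)[OF F] B(1) C(1) clopenin_act[OF k] by blast+
  have kC: "\<phi> k ` C \<subseteq> B"
    using D(2) C(2) by blast
  have "\<phi> k ` (B \<inter> D - C) = \<phi> k ` (B \<inter> D) - \<phi> k ` C"
    using inj_on_image_set_diff[OF act_inj[OF k], of "B \<inter> D" C] sub C(2) by auto
  then have rest: "\<phi> k ` (B \<inter> D - C) \<subseteq> B - \<phi> k ` C"
    using D(2) by auto
  \<comment> \<open>Both remainders are moieties: they contain the half left over or its image under
    \<open>k\<close>, and their complements contain \<open>C\<close> or its image under
    \<open>k\<close>.\<close>
  have "large_in X (B - C)"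
    by (rule large_in_mono[OF C(3) clopenin_Diff[OF cl(1,2)]]) auto
  moreover have "large_in X (topspace X - (B - C))"
    by (rule large_in_mono[OF large_ultrafilterD(1)[OF F C(1)]])
      (use cl sub in \<open>auto intro: clopenin_Diff\<close>)
  moreover have "large_in X (B - \<phi> k ` C)"
    by (rule large_in_mono[OF large_in_act[OF k C(3)] clopenin_Diff[OF cl(1,3)] rest])
  moreover have "large_in X (topspace X - (B - \<phi> k ` C))"
    by (rule large_in_mono[OF large_in_act[OF k large_ultrafilterD(1)[OF F C(1)]]])
      (use cl kC sub in \<open>auto intro: clopenin_Diff\<close>)
  ultimately obtain g0 where g0: "g0 \<in> carrier G" "\<phi> g0 ` (B - C) = B - \<phi> k ` C"
    using ex_act_moiety by metis
  \<comment> \<open>The identity is written with \<open>\<one>\<close>, so that \<open>h\<close>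
    agrees with a group element on each of three clopen pieces, as \<open>ex_glued\<close>
    asks.\<close>
  define h where "h x = (if x \<in> C then \<phi> k x else if x \<in> B then \<phi> g0 x else \<phi> \<one> x)" for x
  have "bij_betw h C (\<phi> k ` C)"
    using inj_on_subset[OF act_inj[OF k] sub(3)] by (simp add: bij_betw_def h_def inj_on_def)
  moreover have "bij_betw h (B - C) (B - \<phi> k ` C)"
    using inj_on_subset[OF act_inj[OF g0(1)], of "B - C"] sub(1) g0(2)
    by (auto simp: bij_betw_def h_def inj_on_def)
  ultimately have "bij_betw h (C \<union> (B - C)) (\<phi> k ` C \<union> (B - \<phi> k ` C))"
    by (rule bij_betw_combine) auto
  then have "bij_betw h B B"
    using kC C(2) by (simp add: Un_absorb1 Un_absorb2)
  moreover have "bij_betw h (topspace X - B) (topspace X - B)"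
  proof -
    have "h x = x" if "x \<in> topspace X - B" for x
      using that C(2) act_one by (auto simp: h_def)
    then show ?thesis
      by (simp add: bij_betw_def inj_on_def cong: image_cong_simp)
  qed
  ultimately have "bij_betw h (B \<union> (topspace X - B)) (B \<union> (topspace X - B))"
    by (rule bij_betw_combine) auto
  then have bij: "bij_betw h (topspace X) (topspace X)"
    using sub(1) by (simp add: Un_absorb1)
  have "\<exists>U g. openin X U \<and> x \<in> U \<and> g \<in> carrier G \<and> (\<forall>y\<in>U. h y = \<phi> g y)"
    if x: "x \<in> topspace X" for x
  proof -
    consider "x \<in> C" | "x \<in> B - C" | "x \<in> topspace X - B"
      using x by blast
    then show ?thesis
    proof cases
      case 1
      then show ?thesis
        using cl(2) k by (intro exI[of _ C] exI[of _ k]) (auto simp: clopenin_def h_def)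
    next
      case 2
      then show ?thesis
        using clopenin_Diff[OF cl(1,2)] g0(1)
        by (intro exI[of _ "B - C"] exI[of _ g0]) (auto simp: clopenin_def h_def)
    next
      case 3
      then show ?thesis
        using clopenin_Diff[OF clopenin_topspace cl(1)] C(2)
        by (intro exI[of _ "topspace X - B"] exI[of _ \<one>]) (auto simp: clopenin_def h_def)
    qed
  qed
  then obtain g where g: "g \<in> carrier G" "\<And>x. x \<in> topspace X \<Longrightarrow> \<phi> g x = h x"
    using ex_glued[OF bij] by blast
  note gF = large_ultrafilter_translate[OF g(1) F]
  \<comment> \<open>On \<open>A' \<inter> C\<close>, a member of \<open>F\<close>, the witness
    agrees with \<open>k\<close>; so the image of this set is in the translate by \<open>g\<close>,
    and it lies inside \<open>A\<close>.\<close>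
  have "translate k F \<subseteq> translate g F"
  proof
    fix A assume A: "A \<in> translate k F"
    then obtain A' where A': "A' \<in> F" "A = \<phi> k ` A'"
      by (auto simp: translate_def)
    have "\<phi> g ` (A' \<inter> C) = \<phi> k ` (A' \<inter> C)"
      using g(2) sub(3) by (intro image_cong) (auto simp: h_def)
    moreover have "A' \<inter> C \<in> F"
      using large_ultrafilterD(4)[OF F] A'(1) C(1) .
    ultimately have "\<phi> k ` (A' \<inter> C) \<in> translate g F"
      unfolding translate_def by (metis image_eqI)
    then show "A \<in> translate g F"
      by (rule large_ultrafilter_mono[OF gF _ large_ultrafilterD(2)[OF kF A]]) (use A' in auto)
  qed
  then have "translate g F = translate k F"
    using large_ultrafilter_eqI[OF kF gF] by simp
  moreover have "\<phi> g x = x" if "x \<in> topspace X - B" for x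
    using that g(2) act_one C(2) by (auto simp: h_def)
  ultimately show thesis
    using that[OF g(1)] by blast
qed

text \<open>Each member of \<open>F\<close> can be shrunk to its part outside \<open>B\<close>,
  which is still in \<open>F\<close> and is fixed pointwise by \<open>g\<close>.\<close>

lemma translate_supported:
  assumes F: "large_ultrafilter X F" and g: "g \<in> carrier G"
    and B: "clopenin X B" "B \<notin> F" and fix_g: "\<And>x. x \<in> topspace X - B \<Longrightarrow> \<phi> g x = x"
  shows "translate g F = F"
proof -
  note gF = large_ultrafilter_translate[OF g F]
  have "F \<subseteq> translate g F"
  proof
    fix A assume A: "A \<in> F"
    have *: "A \<inter> (topspace X - B) \<in> F"
      by (intro large_ultrafilterD(4,5)[OF F] A B)
    have "\<phi> g ` (A \<inter> (topspace X - B)) = A \<inter> (topspace X - B)"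
      using fix_g by (force simp: image_iff)
    then have "A \<inter> (topspace X - B) \<in> translate g F"
      using * unfolding translate_def by (metis image_eqI)
    then show "A \<in> translate g F"
      by (rule large_ultrafilter_mono[OF gF _ large_ultrafilterD(2)[OF F A]]) auto
  qed
  then show ?thesis
    using large_ultrafilter_eqI[OF F gF] by simp
qed

text \<open>Some member of \<open>F\<close> avoids one half of \<open>B\<close> and can be carried
  onto that half, which then lies in the translate but not in \<open>F\<close>. With
  \<open>B\<close> the whole space this makes the stabiliser proper; the freedom in \<open>B\<close>
  serves \<open>inj_on_stabiliser\<close>.\<close>

lemma ex_translate_neq:
  assumes F: "large_ultrafilter X F" and B: "B \<in> F"
  obtains k where "k \<in> carrier G" "B \<in> translate k F" "translate k F \<noteq> F"
proof -
  obtain C1 where C1: "C1 \<subseteq> B" "large_in X C1" "large_in X (B - C1)"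
    using large_in_split[OF large_ultrafilterD(1)[OF F B]] .
  note result = that
  have dich: thesis if C: "C \<in> F" "large_in X C'" "C \<inter> C' = {}" "C' \<subseteq> B" for C C'
  proof -
    have sub: "C \<subseteq> topspace X" "C' \<subseteq> topspace X"
      using large_ultrafilterD(3)[OF F C(1)] clopenin_subset[OF large_in_clopenin[OF C(2)]] by blast+
    have "large_in X (topspace X - C)"
      by (rule large_in_mono[OF C(2)])
        (use C sub large_ultrafilterD(2)[OF F] in \<open>auto intro: clopenin_Diff\<close>)
    moreover have "large_in X (topspace X - C')"
      by (rule large_in_mono[OF large_ultrafilterD(1)[OF F C(1)]])
        (use C sub large_in_clopenin[OF C(2)] in \<open>auto intro: clopenin_Diff\<close>)
    ultimately obtain k where k: "k \<in> carrier G" "\<phi> k ` C = C'"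
      using ex_act_moiety[of C C'] C(2) large_ultrafilterD(1)[OF F C(1)] by blast
    then have "C' \<in> translate k F"
      using C(1) by (auto simp: translate_def)
    moreover have "C' \<notin> F"
      using large_ultrafilter_disjointD[OF F] C by blast
    moreover have "B \<in> translate k F"
      by (rule large_ultrafilter_mono[OF large_ultrafilter_translate[OF k(1) F]])
        (use \<open>C' \<in> translate k F\<close> C large_ultrafilterD(2)[OF F B] in auto)
    ultimately show thesis
      using result[OF k(1)] C(1) by auto
  qed
  show thesis
  proof (cases "C1 \<in> F")
    case True
    show thesis
      by (rule dich[OF True C1(3)]) auto
  next
    case False
    then have "topspace X - C1 \<in> F"
      by (intro large_ultrafilterD(5)[OF F] large_in_clopenin C1)
    then show thesis
      by (rule dich[OF _ C1(2)]) (use C1 in auto)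
  qed
qed

section \<open>Maximality and separation of stabilisers\<close>

definition stabiliser :: "'a set set \<Rightarrow> 'g set" where
  "stabiliser F = {g \<in> carrier G. translate g F = F}"

lemma translate_inv:
  assumes "g \<in> carrier G" "F \<subseteq> Pow (topspace X)"
  shows "translate (inv g) (translate g F) = F"
  using translate_mult[of g "inv g" F] translate_one[of F] assms by simp

lemma subgroup_stabiliser:
  assumes "large_ultrafilter X F"
  shows "subgroup (stabiliser F) G"
proof (rule subgroupI)
  have F: "F \<subseteq> Pow (topspace X)"
    using large_ultrafilter_Pow[OF assms] .
  show "stabiliser F \<subseteq> carrier G" "stabiliser F \<noteq> {}"
    using translate_one[OF F] by (auto simp: stabiliser_def)
  show "inv g \<in> stabiliser F" if "g \<in> stabiliser F" for g
    using that translate_inv[OF _ F, of g] by (simp add: stabiliser_def)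
  show "g \<otimes> h \<in> stabiliser F" if "g \<in> stabiliser F" "h \<in> stabiliser F" for g h
    using that translate_mult[OF _ _ F] by (auto simp: stabiliser_def)
qed

text \<open>
  The action on the translates of \<open>F\<close> is doubly transitive, so that point stabilisers are maximal.
\<close>
lemma maximal_subgroup_stabiliser:
  assumes F: "large_ultrafilter X F"
  shows "maximal_subgroup (stabiliser F) G"
  unfolding maximal_subgroup_def
proof (intro conjI notI)
  show "subgroup (stabiliser F) G"
    using subgroup_stabiliser[OF F] .
  show False if "stabiliser F = carrier G"
    using ex_translate_neq[OF F large_ultrafilter_topspace[OF F]] that
    by (auto simp: stabiliser_def)
  assume "\<exists>H. subgroup H G \<and> stabiliser F \<subset> H \<and> H \<subset> carrier G"
  then obtain H where H: "subgroup H G" "stabiliser F \<subset> H" "H \<subset> carrier G"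
    by blast
  then obtain h g where hg: "h \<in> H" "h \<notin> stabiliser F" "g \<in> carrier G" "g \<notin> H"
    by blast
  have h: "h \<in> carrier G"
    using hg H by blast
  have FP: "F \<subseteq> Pow (topspace X)"
    using large_ultrafilter_Pow[OF F] .
  have ne: "translate h F \<noteq> F" "translate g F \<noteq> F"
    using hg h H by (auto simp: stabiliser_def)
  note hF = large_ultrafilter_translate[OF h F] and gF = large_ultrafilter_translate[OF hg(3) F]
  \<comment> \<open>Each translate differs from \<open>F\<close>, so it misses some member of
    \<open>F\<close>; the intersection of the two members lies in neither translate.\<close>
  obtain A1 A2 where A12: "A1 \<in> F" "A1 \<notin> translate h F" "A2 \<in> F" "A2 \<notin> translate g F"
    using ne large_ultrafilter_eqI[OF F hF] large_ultrafilter_eqI[OF F gF] by blast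
  define A where "A = A1 \<inter> A2"
  have A: "A \<in> F"
    unfolding A_def using A12 by (intro large_ultrafilterD(4)[OF F])
  have clA: "clopenin X A" "A \<subseteq> topspace X"
    using large_ultrafilterD[OF F] A by blast+
  have "A \<notin> translate h F" "A \<notin> translate g F"
    using A12 large_ultrafilter_mono[OF hF, of A A1] large_ultrafilter_mono[OF gF, of A A2]
      large_ultrafilterD(2)[OF F] by (auto simp: A_def)
  then have B: "topspace X - A \<in> translate h F" "topspace X - A \<in> translate g F"
    using large_ultrafilterD(5)[OF hF clA(1)] large_ultrafilterD(5)[OF gF clA(1)] by blast+
  \<comment> \<open>\<open>inv h \<otimes> g\<close> takes one translate to the other, and both
    contain the complement of \<open>A\<close>. It is then replaced by \<open>m\<close>, which is
    the identity on \<open>A\<close> and hence stabilises \<open>F\<close>.\<close>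
  have k: "translate (inv h \<otimes> g) (translate h F) = translate g F"
    using translate_mult[of "inv h" g "translate h F"] translate_inv[OF h FP]
      large_ultrafilter_Pow[OF hF] h hg(3) by simp
  obtain m where m: "m \<in> carrier G" "\<And>x. x \<in> topspace X - (topspace X - A) \<Longrightarrow> \<phi> m x = x"
    "translate m (translate h F) = translate g F"
    using ex_supported_translate[OF hF, of "inv h \<otimes> g" "topspace X - A"] k B h hg(3) by auto
  have "topspace X - A \<notin> F"
    using large_ultrafilter_compl_iff[OF F clA(1)] A by simp
  then have "translate m F = F"
    using translate_supported[OF F m(1) clopenin_Diff[OF clopenin_topspace clA(1)]] m(2) by blast
  then have mH: "m \<in> H"
    using H(2) m(1) unfolding stabiliser_def by blast
  \<comment> \<open>First \<open>h\<close>, then \<open>m\<close> has the same effect on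
    \<open>F\<close> as \<open>g\<close>, so \<open>g\<close> differs from
    \<open>h \<otimes> m\<close> by a stabilising element and falls into \<open>H\<close>.\<close>
  have "translate (h \<otimes> m \<otimes> inv g) F = F"
    using translate_mult[of "h \<otimes> m" "inv g" F] translate_mult[of h m F] translate_inv[OF hg(3) FP]
      FP h m hg(3) by simp
  then have "h \<otimes> m \<otimes> inv g \<in> stabiliser F"
    using h m(1) hg(3) by (simp add: stabiliser_def)
  then have "h \<otimes> m \<otimes> inv g \<in> H"
    using H(2) by blast
  then have "inv (h \<otimes> m \<otimes> inv g) \<otimes> (h \<otimes> m) \<in> H"
    using H(1) hg(1) mH by (simp add: subgroup.m_closed subgroup.m_inv_closed del: inv_mult_group)
  moreover have "inv (h \<otimes> m \<otimes> inv g) \<otimes> (h \<otimes> m) = g"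
    using inv_mult_group[of "h \<otimes> m" "inv g"] m_assoc[of g "inv (h \<otimes> m)" "h \<otimes> m"] h m(1) hg(3)
    by (simp del: inv_mult_group)
  ultimately show False
    using hg(4) by simp
qed

text \<open>For \<open>A\<close> in \<open>F\<close> but not in \<open>F'\<close>, some element
  supported off \<open>A\<close> moves \<open>F'\<close>; it leaves \<open>F\<close> fixed and so
  belongs to only one of the stabilisers.\<close>

lemma inj_on_stabiliser: "inj_on stabiliser {F. large_ultrafilter X F}"
proof (rule inj_onI, rule ccontr)
  fix F F' assume "F \<in> {F. large_ultrafilter X F}" "F' \<in> {F. large_ultrafilter X F}"
    and eq: "stabiliser F = stabiliser F'" and "F \<noteq> F'"
  then have F: "large_ultrafilter X F" and F': "large_ultrafilter X F'" and "\<not> F \<subseteq> F'"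
    using large_ultrafilter_eqI by auto
  then obtain A where A: "A \<in> F" "A \<notin> F'"
    by blast
  have cl: "clopenin X A" "A \<subseteq> topspace X"
    using large_ultrafilterD[OF F] A by blast+
  have B: "topspace X - A \<in> F'" "topspace X - A \<notin> F"
    using large_ultrafilter_compl_iff[OF F cl(1)] large_ultrafilter_compl_iff[OF F' cl(1)] A by blast+
  \<comment> \<open>The complement of \<open>A\<close> must stay in the moved ultrafilter for
    \<open>ex_supported_translate\<close> to replace \<open>k\<close> by an element supported
    there.\<close>
  obtain k where k: "k \<in> carrier G" "topspace X - A \<in> translate k F'" "translate k F' \<noteq> F'"
    using ex_translate_neq[OF F' B(1)] .
  obtain g where g: "g \<in> carrier G" "\<And>x. x \<in> topspace X - (topspace X - A) \<Longrightarrow> \<phi> g x = x"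
    "translate g F' = translate k F'"
    using ex_supported_translate[OF F' k(1) B(1) k(2)] by blast
  have "g \<in> stabiliser F"
    using translate_supported[OF F g(1) clopenin_Diff[OF clopenin_topspace cl(1)] B(2)] g(1,2)
    by (simp add: stabiliser_def)
  moreover have "g \<notin> stabiliser F'"
    using g(3) k(3) by (simp add: stabiliser_def)
  ultimately show False
    using eq by simp
qed

end

section \<open>Counting\<close>

text \<open>
  The independent family of Fichtenholz, Kantorovich and Hausdorff: code the pairs of a finite subset \<open>S\<close> of \<open>P\<close> and a finite
  set of subsets of \<open>S\<close> by the elements of \<open>P\<close>, and let \<open>w A\<close> consist of the codes
  of all \<open>(S, T)\<close> with \<open>A \<inter> S \<in> T\<close>.
\<close>
lemma ex_independent_family:
  assumes "infinite P"
  shows "\<exists>w. (\<forall>A. w A \<subseteq> P) \<and>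
    (\<forall>\<A> \<B>. \<A> \<subseteq> Pow P \<and> \<B> \<subseteq> Pow P \<and> finite \<A> \<and> finite \<B> \<and> \<A> \<inter> \<B> = {} \<longrightarrow>
      (\<exists>i\<in>P. (\<forall>A\<in>\<A>. i \<in> w A) \<and> (\<forall>B\<in>\<B>. i \<notin> w B)))"
proof -
  \<comment> \<open>\<open>T\<close> ranges over all finite sets of finite subsets of
    \<open>P\<close>, whether or not they lie below \<open>S\<close>; the pairs still number at most
    \<open>|P|\<close>.\<close>
  let ?I = "Fpow P \<times> Fpow (Fpow P)"
  have P1: "|Fpow P| =o |P|"
    using assms by simp
  then have inf: "infinite (Fpow P)"
    using assms card_of_ordIso_finite by blast
  then have "|Fpow (Fpow P)| =o |P|"
    using card_of_Fpow_infinite[OF inf] P1 ordIso_transitive by blast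
  then have "|Fpow (Fpow P)| \<le>o |Fpow P|"
    using card_of_Fpow_infinite[OF inf] ordIso_imp_ordLeq by blast
  then have "|?I| =o |Fpow P|"
    using card_of_Times_infinite[OF inf, of "Fpow (Fpow P)"] Fpow_not_empty by blast
  then have "|?I| \<le>o |P|"
    using P1 ordIso_transitive ordIso_imp_ordLeq by blast
  then obtain b where b: "inj_on b ?I" "b ` ?I \<subseteq> P"
    by (auto simp: card_of_ordLeq[symmetric])
  define w where "w A = b ` {(S, T). (S, T) \<in> ?I \<and> A \<inter> S \<in> T}" for A
  show ?thesis
  proof (intro exI[of _ w] conjI allI impI; (elim conjE)?)
    show "w A \<subseteq> P" for A
      using b(2) unfolding w_def by blast
    fix \<A> \<B> :: "'a set set"
    assume sub: "\<A> \<subseteq> Pow P" "\<B> \<subseteq> Pow P" and fin: "finite \<A>" "finite \<B>" and disj: "\<A> \<inter> \<B> = {}"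
    have "\<exists>x. (x \<in> A) \<noteq> (x \<in> B)" if "A \<in> \<A>" "B \<in> \<B>" for A B
    proof -
      have "A \<noteq> B"
        using that disj by auto
      then show ?thesis
        by (simp add: set_eq_iff)
    qed
    then obtain d where d: "\<And>A B. A \<in> \<A> \<Longrightarrow> B \<in> \<B> \<Longrightarrow> (d A B \<in> A) \<noteq> (d A B \<in> B)"
      by metis
    \<comment> \<open>\<open>S\<close> holds a point separating each \<open>A\<close> from each
      \<open>B\<close>, and \<open>T\<close> consists of the traces of the sets \<open>A\<close> on
      \<open>S\<close>; so no \<open>B\<close> has its trace in \<open>T\<close>.\<close>
    define S where "S = (\<lambda>(A, B). d A B) ` (\<A> \<times> \<B>)"
    define T where "T = (\<lambda>A. A \<inter> S) ` \<A>"
    have "S \<subseteq> P"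
    proof
      fix x assume "x \<in> S"
      then obtain A B where AB: "A \<in> \<A>" "B \<in> \<B>" "x = d A B"
        by (auto simp: S_def)
      with d[OF AB(1,2)] sub show "x \<in> P"
        by blast
    qed
    then have S: "S \<in> Fpow P"
      using fin by (auto simp: S_def Fpow_def)
    then have "T \<in> Fpow (Fpow P)"
      using fin by (auto simp: T_def Fpow_def)
    with S have ST: "(S, T) \<in> ?I"
      by blast
    have mem: "b (S, T) \<in> w A \<longleftrightarrow> A \<inter> S \<in> T" for A
    proof
      assume "b (S, T) \<in> w A"
      then obtain S' T' where "(S', T') \<in> ?I" "A \<inter> S' \<in> T'" "b (S, T) = b (S', T')"
        unfolding w_def by blast
      then show "A \<inter> S \<in> T"
        using inj_onD[OF b(1) _ ST, of "(S', T')"] by simp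
    qed (use ST in \<open>auto simp: w_def\<close>)
    have "b (S, T) \<notin> w B" if B: "B \<in> \<B>" for B
    proof
      assume "b (S, T) \<in> w B"
      then obtain A where A: "A \<in> \<A>" "B \<inter> S = A \<inter> S"
        unfolding mem by (auto simp: T_def)
      moreover have "d A B \<in> S"
        using A(1) B by (force simp: S_def)
      ultimately show False
        using d[OF A(1) B] by blast
    qed
    moreover have "b (S, T) \<in> w A" if "A \<in> \<A>" for A
      unfolding mem using that by (simp add: T_def)
    moreover have "b (S, T) \<in> P"
      using b(2) ST by blast
    ultimately show "\<exists>i\<in>P. (\<forall>A\<in>\<A>. i \<in> w A) \<and> (\<forall>B\<in>\<B>. i \<notin> w B)"
      by blast
  qed
qed

lemma ctwo_cexp_card_of: "|A| =o r \<Longrightarrow> ctwo ^c r =o |Pow A|"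
proof -
  assume "|A| =o r"
  then have "ctwo ^c r =o ctwo ^c |A|"
    by (metis card_of_Card_order cexp_cong2 Card_order_ctwo ordIso_symmetric)
  also have "ctwo ^c |A| =o |Pow A|"
    unfolding cexp_def ctwo_def Field_card_of by (rule ordIso_symmetric[OF card_of_Pow_Func])
  finally show ?thesis .
qed

text \<open>Each \<open>Z \<subseteq> Pow P\<close> prescribes, for every
  \<open>A \<subseteq> P\<close>, whether the union \<open>u A\<close> or its complement is to be in
  the ultrafilter. By independence any finite intersection of prescribed sets contains a whole block
  of the partition, so it is large and an ultrafilter exists.\<close>

lemma (in homeoclastic_space) card_large_ultrafilters:
  assumes P: "partition_on (topspace X) P" "\<forall>M\<in>P. topological_moiety X M" and inf: "infinite P"
  shows "|Pow (Pow P)| \<le>o |{F. large_ultrafilter X F}|"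
proof -
  obtain w where w: "\<forall>A. w A \<subseteq> P"
    and indep: "\<forall>\<A> \<B>. \<A> \<subseteq> Pow P \<and> \<B> \<subseteq> Pow P \<and> finite \<A> \<and> finite \<B> \<and> \<A> \<inter> \<B> = {} \<longrightarrow>
      (\<exists>i\<in>P. (\<forall>A\<in>\<A>. i \<in> w A) \<and> (\<forall>B\<in>\<B>. i \<notin> w B))"
    using ex_independent_family[OF inf] by (elim exE conjE)
  have wP: "w A \<subseteq> P" for A
    using w by simp
  define u where "u A = \<Union>(w A)" for A
  have Un: "\<Union>P = topspace X" and disjP: "\<And>M N. M \<in> P \<Longrightarrow> N \<in> P \<Longrightarrow> M \<noteq> N \<Longrightarrow> M \<inter> N = {}"
    using P(1) by (auto simp: partition_on_def disjoint_def)
  have compl: "topspace X - \<Union>Q = \<Union>(P - Q)" if "Q \<subseteq> P" for Q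
  proof
    show "topspace X - \<Union>Q \<subseteq> \<Union>(P - Q)"
      using Un by blast
    show "\<Union>(P - Q) \<subseteq> topspace X - \<Union>Q"
      using Un that disjP by fastforce
  qed
  have opn: "openin X (\<Union>Q)" if "Q \<subseteq> P" for Q
    using P(2) that by (intro openin_Union) (auto simp: topological_moiety_def)
  have clopen_u: "clopenin X (u A)" for A
    using opn[of "P - w A"] compl[OF wP[of A]] opn[OF wP[of A]] openin_subset[OF opn[OF wP[of A]]]
    by (simp add: clopenin_def closedin_def u_def Diff_subset)
  have "\<exists>F. u ` Z \<union> (\<lambda>A. topspace X - u A) ` (Pow P - Z) \<subseteq> F \<and> large_ultrafilter X F"
    if Z: "Z \<subseteq> Pow P" for Z
  proof -
    let ?E = "u ` Z \<union> (\<lambda>A. topspace X - u A) ` (Pow P - Z)"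
    have clE: "\<forall>A\<in>?E. clopenin X A"
      using clopen_u clopenin_Diff clopenin_topspace by blast
    have "large_in X (topspace X \<inter> \<Inter>S)" if S: "finite S" "S \<subseteq> ?E" for S
    proof -
      \<comment> \<open>Finitely many indices account for \<open>S\<close>. Those of the unions come
        from \<open>Z\<close>, those of the complements from outside \<open>Z\<close>, so they are
        disjoint as \<open>indep\<close> demands.\<close>
      have "finite (S \<inter> u ` Z)" "S \<inter> u ` Z \<subseteq> u ` Z"
        using S(1) by auto
      then obtain \<A> where \<A>: "\<A> \<subseteq> Z" "finite \<A>" "S \<inter> u ` Z = u ` \<A>"
        using finite_subset_image by metis
      have "finite (S - u ` Z)" "S - u ` Z \<subseteq> (\<lambda>A. topspace X - u A) ` (Pow P - Z)"
        using S by auto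
      then obtain \<B> where \<B>: "\<B> \<subseteq> Pow P - Z" "finite \<B>"
          "S - u ` Z = (\<lambda>A. topspace X - u A) ` \<B>"
        using finite_subset_image by metis
      have "\<exists>i\<in>P. (\<forall>A\<in>\<A>. i \<in> w A) \<and> (\<forall>B\<in>\<B>. i \<notin> w B)"
        using \<A> \<B> Z by (intro indep[rule_format]) auto
      then obtain i where i: "i \<in> P" "\<And>A. A \<in> \<A> \<Longrightarrow> i \<in> w A" "\<And>B. B \<in> \<B> \<Longrightarrow> i \<notin> w B"
        by auto
      have "i \<subseteq> s" if "s \<in> S" for s
      proof (cases "s \<in> u ` Z")
        case True
        then have "s \<in> u ` \<A>"
          using that unfolding \<A>(3)[symmetric] by simp
        then obtain A where "A \<in> \<A>" "s = u A"
          by (elim imageE)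
        then show ?thesis
          using i(2)[of A] unfolding u_def by auto
      next
        case False
        then have "s \<in> (\<lambda>A. topspace X - u A) ` \<B>"
          using that unfolding \<B>(3)[symmetric] by simp
        then obtain B where "B \<in> \<B>" "s = topspace X - u B"
          by (elim imageE)
        then show ?thesis
          using i(1) i(3)[of B] compl[OF wP, of B] unfolding u_def by auto
      qed
      moreover have "large_in X i"
        using P(2) i(1) by (simp add: topological_moiety_iff)
      moreover have "i \<subseteq> topspace X"
        using i(1) Un by blast
      moreover have "clopenin X (topspace X \<inter> \<Inter>S)"
        using clE S by (intro clopenin_Inter) auto
      ultimately show ?thesis
        using large_in_mono[of i "topspace X \<inter> \<Inter>S"] by blast
    qed
    then obtain F where "?E \<subseteq> F" "large_ultrafilter X F"
      using ex_large_ultrafilter[OF clE] by auto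
    then show ?thesis
      by blast
  qed
  then obtain f where f: "\<And>Z. Z \<subseteq> Pow P \<Longrightarrow> u ` Z \<union> (\<lambda>A. topspace X - u A) ` (Pow P - Z) \<subseteq> f Z"
      "\<And>Z. Z \<subseteq> Pow P \<Longrightarrow> large_ultrafilter X (f Z)"
    by metis
  \<comment> \<open>An \<open>A\<close> in \<open>Z\<close> but not in \<open>Z'\<close> would put
    both \<open>u A\<close> and its complement into the common ultrafilter.\<close>
  have "Z \<subseteq> Z'" if Z: "Z \<subseteq> Pow P" "Z' \<subseteq> Pow P" "f Z = f Z'" for Z Z'
  proof (rule ccontr)
    assume "\<not> Z \<subseteq> Z'"
    then obtain A where A: "A \<in> Z" "A \<in> Pow P - Z'"
      using Z(1) by blast
    have "u A \<in> f Z" "topspace X - u A \<in> f Z"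
      using f(1)[OF Z(1)] f(1)[OF Z(2)] A Z(3) by auto
    then show False
      using large_ultrafilter_disjointD[OF f(2)[OF Z(1)]] by blast
  qed
  then have "inj_on f (Pow (Pow P))"
    by (intro inj_onI) (simp add: subset_antisym)
  then show ?thesis
    using f(2) by (intro card_of_ordLeqI[where f = f]) auto
qed

section \<open>Upper bounds for the size of the group\<close>

lemma card_homeo_group:
  fixes X :: "'a topology"
  assumes X: "Hausdorff_space X" and \<B>: "openin X = arbitrary union_of (\<lambda>U. U \<in> \<B>)"
  shows "|carrier (homeo_group X)| \<le>o |Pow (\<B> \<times> \<B>)|"
proof (rule card_of_ordLeqI)
  \<comment> \<open>If \<open>f x\<close> and \<open>g x\<close> differ, a basic \<open>W\<close>
    around \<open>f x\<close> avoiding \<open>g x\<close> and a basic \<open>U\<close> around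
    \<open>x\<close> mapped into \<open>W\<close> by \<open>f\<close> form a pair in
    \<open>c f\<close> but not in \<open>c g\<close>.\<close>
  define c where "c f = {(U, V) \<in> \<B> \<times> \<B>. f ` U \<subseteq> V}" for f :: "'a \<Rightarrow> 'a"
  show "c f \<in> Pow (\<B> \<times> \<B>)" for f
    by (auto simp: c_def)
  have basis: "\<exists>U\<in>\<B>. x \<in> U \<and> U \<subseteq> W" if "openin X W" "x \<in> W" for W x
    using that unfolding \<B> arbitrary_union_of_alt by blast
  have \<B>_open: "openin X U" if "U \<in> \<B>" for U
    using that unfolding \<B> by (rule arbitrary_union_of_inc)
  show "inj_on c (carrier (homeo_group X))"
  proof (rule inj_onI)
    fix f g assume "f \<in> carrier (homeo_group X)" "g \<in> carrier (homeo_group X)" and eq: "c f = c g"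
    then have f: "f \<in> extensional (topspace X)" "continuous_map X X f"
      and g: "g \<in> extensional (topspace X)" "continuous_map X X g"
      by (auto simp: homeo_group_def homeomorphic_imp_continuous_map)
    have "f x = g x" if x: "x \<in> topspace X" for x
    proof (rule ccontr)
      assume ne: "f x \<noteq> g x"
      have "f x \<in> topspace X" "g x \<in> topspace X"
        using f(2) g(2) x by (auto simp: continuous_map_def)
      then obtain V V' where V: "openin X V" "f x \<in> V" "g x \<in> V'" "disjnt V V'"
        using X ne unfolding Hausdorff_space_def by meson
      obtain W where W: "W \<in> \<B>" "f x \<in> W" "W \<subseteq> V"
        using basis[OF V(1,2)] by blast
      have "openin X {x \<in> topspace X. f x \<in> W}"
        using openin_continuous_map_preimage[OF f(2) \<B>_open[OF W(1)]] .
      then obtain U where U: "U \<in> \<B>" "x \<in> U" "U \<subseteq> {x \<in> topspace X. f x \<in> W}"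
        using basis[of "{x \<in> topspace X. f x \<in> W}" x] x W(2) by blast
      then have "(U, W) \<in> c f"
        using W(1) by (auto simp: c_def)
      then have "g x \<in> W"
        using U(2) unfolding eq by (auto simp: c_def)
      then show False
        using V W(3) by (auto simp: disjnt_def)
    qed
    then show "f = g"
      using extensionalityI[OF f(1) g(1)] by blast
  qed
qed

text \<open>The group is the union of the fibres over the image, and multiplication by the inverse
  of one element embeds its fibre into the kernel.\<close>

lemma (in group_hom) card_carrier_le_kernel_image:
  assumes r: "Cinfinite r" and ker: "|kernel G H h| \<le>o r" and im: "|h ` carrier G| \<le>o r"
  shows "|carrier G| \<le>o r"
proof -
  have "|{g \<in> carrier G. h g = y}| \<le>o r" if y: "y \<in> h ` carrier G" for y
  proof -
    obtain g0 where g0: "g0 \<in> carrier G" "y = h g0"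
      using y by (elim imageE)
    have "|{g \<in> carrier G. h g = y}| \<le>o |kernel G H h|"
    proof (rule card_of_ordLeqI)
      show "inj_on (\<lambda>g. g \<otimes> inv g0) {g \<in> carrier G. h g = y}"
        using g0(1) by (intro inj_onI) simp
      show "g \<otimes> inv g0 \<in> kernel G H h" if "g \<in> {g \<in> carrier G. h g = y}" for g
        using that g0 by (simp add: kernel_def)
    qed
    then show ?thesis
      using ker by (rule ordLeq_transitive)
  qed
  then have "|\<Union>y \<in> h ` carrier G. {g \<in> carrier G. h g = y}| \<le>o r"
    by (intro UNION_Cinfinite_bound[OF im _ r] ballI)
  moreover have "(\<Union>y \<in> h ` carrier G. {g \<in> carrier G. h g = y}) = carrier G"
    by auto
  ultimately show ?thesis
    by simp
qed

theorem theorem2p9: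
  fixes \<kappa> :: "'k rel"
    and X :: "'a topology"
    and G :: "('g, 'b) monoid_scheme"
    and \<phi> :: "'g \<Rightarrow> 'a \<Rightarrow> 'a"
  assumes "Cinfinite \<kappa>"
    and "card_homeoclastic \<kappa> X"
    and "group G"
    and "\<phi> \<in> hom G (homeo_group X)"
    and "fully_emulates_Homeo G \<phi> X"
  shows "ctwo ^c (ctwo ^c \<kappa>) \<le>o |{M. maximal_subgroup M G}| \<and>
    (has_basis_of_size X \<kappa> \<and> |kernel G (homeo_group X) \<phi>| \<le>o ctwo ^c \<kappa> \<longrightarrow>
      |{M. maximal_subgroup M G}| =o ctwo ^c (ctwo ^c \<kappa>))"
proof -
  obtain P where X: "homeoclastic X" and P: "partition_on (topspace X) P"
      "\<forall>M\<in>P. topological_moiety X M" "|P| =o \<kappa>"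
    using assms(2) by (auto simp: card_homeoclastic_def)
  have infP: "infinite P"
    using assms(1) Cinfinite_cong[OF ordIso_symmetric[OF P(3)] assms(1)]
    by (simp add: cinfinite_def Field_card_of)
  then have "\<exists>M. topological_moiety X M"
    using P(2) by (metis finite.emptyI ex_in_conv)
  then interpret fully_emulating_action X G \<phi>
    using X assms by (simp add: fully_emulating_action_def fully_emulating_action_axioms_def
        homeoclastic_space_def fully_emulates_Homeo_def)
  \<comment> \<open>The partition \<open>P\<close> stands in for \<open>\<kappa>\<close>, so that
    cardinal powers become power sets.\<close>
  have two: "ctwo ^c \<kappa> =o |Pow P|"
    using ctwo_cexp_card_of[OF P(3)] .
  then have twotwo: "ctwo ^c (ctwo ^c \<kappa>) =o |Pow (Pow P)|"
    using ctwo_cexp_card_of ordIso_symmetric by blast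
  have "|{F. large_ultrafilter X F}| \<le>o |{M. maximal_subgroup M G}|"
    by (rule card_of_ordLeqI[OF inj_on_stabiliser]) (simp add: maximal_subgroup_stabiliser)
  then have lower: "ctwo ^c (ctwo ^c \<kappa>) \<le>o |{M. maximal_subgroup M G}|"
    using twotwo card_large_ultrafilters[OF P(1,2) infP] ordIso_ordLeq_trans ordLeq_transitive by blast
  have upper: "|{M. maximal_subgroup M G}| \<le>o ctwo ^c (ctwo ^c \<kappa>)"
    if basis: "has_basis_of_size X \<kappa>" and ker: "|kernel G (homeo_group X) \<phi>| \<le>o ctwo ^c \<kappa>"
  proof -
    obtain \<B> where \<B>: "openin X = arbitrary union_of (\<lambda>U. U \<in> \<B>)" "|\<B>| =o \<kappa>"
      using basis by (auto simp: has_basis_of_size_def)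
    have \<B>P: "|\<B>| =o |P|"
      using \<B>(2) P(3) ordIso_symmetric ordIso_transitive by blast
    then have "infinite \<B>"
      using infP card_of_ordIso_finite by blast
    then have "|\<B> \<times> \<B>| =o |P|"
      using card_of_Times_same_infinite \<B>P ordIso_transitive by blast
    then have "|Pow (\<B> \<times> \<B>)| =o |Pow P|"
      by (rule card_of_Pow_cong)
    then have "|Pow (\<B> \<times> \<B>)| =o ctwo ^c \<kappa>"
      using two ordIso_symmetric ordIso_transitive by blast
    moreover have "Hausdorff_space X"
      using X by (simp add: homeoclastic_def)
    ultimately have "|carrier (homeo_group X)| \<le>o ctwo ^c \<kappa>"
      using card_homeo_group[OF _ \<B>(1)] ordLeq_ordIso_trans by blast
    moreover have "\<phi> ` carrier G \<subseteq> carrier (homeo_group X)"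
      using hom_in_carrier[OF hom] by blast
    ultimately have "|\<phi> ` carrier G| \<le>o ctwo ^c \<kappa>"
      using card_of_mono1 ordLeq_transitive by blast
    moreover have "Cinfinite (ctwo ^c \<kappa>)"
      using assms(1) by (simp add: Cinfinite_cexp ordLeq_refl Card_order_ctwo)
    ultimately have "|carrier G| \<le>o ctwo ^c \<kappa>"
      using group_hom.card_carrier_le_kernel_image[OF group_hom.intro[OF is_group group_homeo_group
            group_hom_axioms.intro[OF hom]] _ ker] by blast
    \<comment> \<open>Subgroups are bounded simply as subsets of the carrier.\<close>
    then have "|Pow (carrier G)| \<le>o |Pow (Pow P)|"
      using two ordLeq_ordIso_trans card_of_Pow_mono by blast
    moreover have "{M. maximal_subgroup M G} \<subseteq> Pow (carrier G)"
      using subgroup.subset by (auto simp: maximal_subgroup_def)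
    ultimately show ?thesis
      using twotwo card_of_mono1 ordLeq_transitive ordLeq_ordIso_trans ordIso_symmetric by meson
  qed
  show ?thesis
    using lower upper ordIso_iff_ordLeq by blast
qed

end
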